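(* Let $\mathcal{P}$ be a program, $\mathcal{C}$ a program component of $\mathcal{P}$ and $\mathcal{E}_{\mathcal{C}}$ its entry transitions. Given an assertion $(t_{\mathrm{exit}}, \varphi)$ such that $t_{\mathrm{exit}}$ is an exit transition of $\mathcal{C}$ and $\varphi$ is a clause, if $\mathsf{CheckSafe}(\mathcal{P}, \mathcal{C}, \mathcal{E}_{\mathcal{C}}, (t_{\mathrm{exit}}, \varphi)) = \mathsf{Safe}$, then $\mathcal{P}$ is safe for $(t_{\mathrm{exit}}, \varphi)$, i.e., for every evaluation $(\ell_0, \vec v_0) \to^*_{\mathcal{P}} \circ \to_{t_{\mathrm{exit}}} (\ell, \vec v)$ starting at the start location $\ell_0$ and ending with a step using $t_{\mathrm{exit}}$, we have $\vec v \models \varphi$.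
   Context: Programs. Fix integer program variables $\mathcal{V} = \{v_1,\dots,v_n\}$ and primed copies $\mathcal{V}'$ (values after a step); for a formula $\psi$ over $\mathcal{V}$, $\psi'$ denotes it over $\mathcal{V}'$. Let $\mathcal{L}$ be a finite set of locations containing a start location $\ell_0$. A transition is a triple $(\ell,\tau,\ell')$ with $\ell,\ell'\in\mathcal{L}$ and $\tau$ a conjunction of linear inequalities over $\mathcal{V}\cup\mathcal{V}'$ (a transition whose formula is a disjunction, e.g. after conjoining a negated conjunction, is represented by several transitions with the same endpoints, one per disjunct); a program $\mathcal{P}$ is a finite set of transitions viewed as a directed multigraph (control-flow graph) on $\mathcal{L}$. A state is $(\ell,\vec v)$ with $\vec v:\mathcal{V}\to\mathbb{Z}$; a step $(\ell,\vec v)\to_t(\ell',\vec v')$ with $t=(\ell,\tau,\ell')$ means $(\vec v,\vec v')$ satisfies $\tau$; $\to^*_{\mathcal{P}}$ is the reflexive-transitive closure of steps with transitions of $\mathcal{P}$. An assertion is a pair $(t,\varphi)$ of a transition and a formula over $\mathcal{V}$. Components. A program component $\mathcal{C}$ is (the set of transitions of) a strongly connected component of the control-flow graph of $\mathcal{P}$; $\mathsf{component}(\ell,\mathcal{P})$ denotes the component containing location $\ell$ and $\mathsf{entries}(\mathcal{C},\mathcal{P})$ its entry transitions, i.e. transitions $(\ell,\tau,\ell')\notin\mathcal{C}$ with $\ell'$ a location of $\mathcal{C}$. A transition $t\notin\mathcal{C}$ whose source location is a location of $\mathcal{C}$ is an exit transition of $\mathcal{C}$. Procedure $\mathsf{CondSafe}(\mathcal{C},\mathcal{E}_{\mathcal{C}},(t_{\mathrm{exit}},\varphi))$,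 with $t_{\mathrm{exit}}=(\tilde\ell_{\mathrm{exit}},\tau_{\mathrm{exit}},\ell_{\mathrm{exit}})$: for $k=1,\dots,\mathsf{MAX\_CONJUNCTS}$, for each location $\ell$ of $\mathcal{C}$ create a template $I_{\ell,k}\equiv\bigwedge_{j=1}^k\big(i_{\ell,j}+\sum_{v\in\mathcal{V}} i_{\ell,j,v}\cdot v\le 0\big)$ with unknown coefficients; build a weighted Max-SMT problem whose hard constraints are (Consecution) for each $(\ell,\tau,\ell')\in\mathcal{C}$, $I_{\ell,k}\wedge\tau\Rightarrow I'_{\ell',k}$ valid, and (Safety) $I_{\tilde\ell_{\mathrm{exit}},k}\wedge\tau_{\mathrm{exit}}\Rightarrow\varphi'$ valid, and whose soft constraints are (Initiation) for each $(\ell,\tau,\ell')\in\mathcal{E}_{\mathcal{C}}$ and each conjunct $j$, $\tau\Rightarrow$ (the $j$-th conjunct of $I'_{\ell',k}$). If an assignment $\sigma$ satisfying the hard constraints is found, return $\mathcal{Q}=\{\ell\mapsto\sigma(I_{\ell,k})\}$ over the locations of $\mathcal{C}$; if no $k$ succeeds, return $\mathsf{None}$. Procedure $\mathsf{CheckSafe}(\mathcal{P},\mathcal{C},\mathcal{E}_{\mathcal{C}},(t_{\mathrm{exit}},\varphi))$, with $t_{\mathrm{exit}}=(\ell_{\mathrm{exit}},\tau_{\mathrm{exit}},\ell'_{\mathrm{exit}})$, $t_{\mathrm{exit}}$ an exit transition of $\mathcal{C}$ and $\varphi$ a clause, returns $\mathsf{Safe}$ or $\mathsf{Maybe}$ as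 follows. (1) If $\tau_{\mathrm{exit}}\Rightarrow\varphi'$ is valid, return $\mathsf{Safe}$; else if $\ell_{\mathrm{exit}}=\ell_0$, return $\mathsf{Maybe}$. (2) Let $\mathcal{Q}=\mathsf{CondSafe}(\mathcal{C},\mathcal{E}_{\mathcal{C}},(t_{\mathrm{exit}},\varphi))$; if $\mathcal{Q}=\mathsf{None}$, return $\mathsf{Maybe}$. (3) For every $t=(\ell,\tau,\ell')\in\mathcal{E}_{\mathcal{C}}$ and every conjunct (linear inequality) $L$ of $\mathcal{Q}(\ell')$, let $\tilde{\mathcal{C}}=\mathsf{component}(\ell,\mathcal{P})$ and set $\mathsf{res}[t,L]=\mathsf{CheckSafe}(\mathcal{P},\tilde{\mathcal{C}},\mathsf{entries}(\tilde{\mathcal{C}},\mathcal{P}),(t,L))$. (4) If all $\mathsf{res}[t,L]=\mathsf{Safe}$, return $\mathsf{Safe}$. (5) Otherwise (narrowing) let $\hat{\mathcal{E}}_{\mathcal{C}}=\{(\ell,\ \tau\wedge\lnot(\bigwedge_{L\in\mathcal{Q}(\ell'),\ \mathsf{res}[t,L]=\mathsf{Maybe}}L'),\ \ell')\mid t=(\ell,\tau,\ell')\in\mathcal{E}_{\mathcal{C}}\}$ and $\hat{\mathcal{C}}=\{(\ell,\ \tau\wedge\lnot\mathcal{Q}(\ell')'\wedge\lnot\mathcal{Q}(\ell),\ \ell')\mid(\ell,\tau,\ell')\in\mathcal{C}\}$, and return $\mathsf{CheckSafe}(\mathcal{P},\hat{\mathcal{C}},\hat{\mathcal{E}}_{\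mathcal{C}},(t_{\mathrm{exit}},\varphi))$.
   Formalization: Added assumption: the strongly connected component of the start location ℓ0 contains no other location (self-loops allowed). Without it the claim fails: a component containing ℓ0 may have no entry transitions, so an unsatisfiable invariant yields Safe although the exit is reachable. *)

theory Defs
  imports Complex_Main "HOL-Library.Multiset" "Graph_Theory.Digraph_Component"
begin

section \<open>Linear inequalities over integer variables\<close>

text \<open>
  \<open>Le c a\<close> is \<open>c + (\<Sum>x. a x * x) \<le> 0\<close> and \<open>Lt c a\<close> is its strict variant. Strict inequalities
  make the language closed under negation.
\<close>

datatype 'x linineq = Le real "'x \<Rightarrow> real" | Lt real "'x \<Rightarrow> real"

fun sat :: "('x::finite \<Rightarrow> int) \<Rightarrow> 'x linineq \<Rightarrow> bool" where
  "sat \<nu> (Le c a) \<longleftrightarrow> c + (\<Sum>x\<in>UNIV. a x * of_int (\<nu> x)) \<le> 0"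
| "sat \<nu> (Lt c a) \<longleftrightarrow> c + (\<Sum>x\<in>UNIV. a x * of_int (\<nu> x)) < 0"

fun neg :: "'x linineq \<Rightarrow> 'x linineq" where
  "neg (Le c a) = Lt (- c) (\<lambda>x. - a x)"
| "neg (Lt c a) = Le (- c) (\<lambda>x. - a x)"

lemma sat_neg: "sat \<nu> (neg L) \<longleftrightarrow> \<not> sat \<nu> L"
  by (cases L) (auto simp: sum_negf)

text \<open>
  Lists of inequalities are read as conjunctions (\<open>conj\<close>) or as disjunctions (\<open>clause\<close>). In
  formulas over program variables and their primed copies, \<open>Inl v\<close> stands for \<open>v\<close> and \<open>Inr v\<close>
  for \<open>v'\<close>.
\<close>

type_synonym 'x conj = "'x linineq list"
type_synonym 'x clause = "'x linineq list"

definition sat_conj :: "('x::finite \<Rightarrow> int) \<Rightarrow> 'x conj \<Rightarrow> bool" where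
  "sat_conj \<nu> F \<longleftrightarrow> (\<forall>L\<in>set F. sat \<nu> L)"

definition sat_clause :: "('x::finite \<Rightarrow> int) \<Rightarrow> 'x clause \<Rightarrow> bool" where
  "sat_clause \<nu> \<phi> \<longleftrightarrow> (\<exists>L\<in>set \<phi>. sat \<nu> L)"

fun unprimed :: "'v linineq \<Rightarrow> ('v + 'v) linineq" where
  "unprimed (Le c a) = Le c (case_sum a (\<lambda>_. 0))"
| "unprimed (Lt c a) = Lt c (case_sum a (\<lambda>_. 0))"

fun primed :: "'v linineq \<Rightarrow> ('v + 'v) linineq" where
  "primed (Le c a) = Le c (case_sum (\<lambda>_. 0) a)"
| "primed (Lt c a) = Lt c (case_sum (\<lambda>_. 0) a)"

lemma sat_unprimed: "sat (case_sum u u') (unprimed L) \<longleftrightarrow> sat u L"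
  by (cases L) (simp_all flip: UNIV_Plus_UNIV add: sum.Plus)

lemma sat_primed: "sat (case_sum u u') (primed L) \<longleftrightarrow> sat u' L"
  by (cases L) (simp_all flip: UNIV_Plus_UNIV add: sum.Plus)

text \<open>Validity of the implications \<open>F \<Rightarrow> \<And>G\<close> and \<open>F \<Rightarrow> \<Or>\<phi>\<close> over the integers.\<close>

definition entails_conj :: "('x::finite) conj \<Rightarrow> 'x conj \<Rightarrow> bool" where
  "entails_conj F G \<longleftrightarrow> (\<forall>\<nu>. sat_conj \<nu> F \<longrightarrow> sat_conj \<nu> G)"

definition entails_clause :: "('x::finite) conj \<Rightarrow> 'x clause \<Rightarrow> bool" where
  "entails_clause F \<phi> \<longleftrightarrow> (\<forall>\<nu>. sat_conj \<nu> F \<longrightarrow> sat_clause \<nu> \<phi>)"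


section \<open>Programs\<close>

type_synonym ('l, 'v) transition = "'l \<times> ('v + 'v) conj \<times> 'l"
type_synonym ('l, 'v) program = "('l, 'v) transition set"
type_synonym ('l, 'v) state = "'l \<times> ('v \<Rightarrow> int)"
type_synonym ('l, 'v) assertion = "('l, 'v) transition \<times> 'v clause"

definition src :: "('l, 'v) transition \<Rightarrow> 'l" where
  "src t = fst t"

definition guard :: "('l, 'v) transition \<Rightarrow> ('v + 'v) conj" where
  "guard t = fst (snd t)"

definition tgt :: "('l, 'v) transition \<Rightarrow> 'l" where
  "tgt t = snd (snd t)"

definition transition_on :: "'l set \<Rightarrow> ('l, 'v) transition \<Rightarrow> bool" where
  "transition_on \<L> t \<longleftrightarrow> src t \<in> \<L> \<and> tgt t \<in> \<L>"

definition is_program :: "'l set \<Rightarrow> 'l \<Rightarrow> ('l, 'v) program \<Rightarrow> bool" where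
  "is_program \<L> l0 P \<longleftrightarrow> finite \<L> \<and> l0 \<in> \<L> \<and> finite P \<and> (\<forall>t\<in>P. transition_on \<L> t)"

fun step :: "('l, 'v::finite) transition \<Rightarrow> ('l, 'v) state \<Rightarrow> ('l, 'v) state \<Rightarrow> bool" where
  "step t (l, u) (l', u') \<longleftrightarrow> l = src t \<and> l' = tgt t \<and> sat_conj (case_sum u u') (guard t)"

definition program_step :: "('l, 'v::finite) program \<Rightarrow> ('l, 'v) state \<Rightarrow> ('l, 'v) state \<Rightarrow> bool" where
  "program_step P s s' \<longleftrightarrow> (\<exists>t\<in>P. step t s s')"

definition safe_for :: "'l \<Rightarrow> ('l, 'v::finite) program \<Rightarrow> ('l, 'v) assertion \<Rightarrow> bool" where
  "safe_for l0 P A \<longleftrightarrow> (case A of (t, \<phi>) \<Rightarrow>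
     (\<forall>u0 s l u. (program_step P)\<^sup>*\<^sup>* (l0, u0) s \<longrightarrow> step t s (l, u) \<longrightarrow> sat_clause u \<phi>))"


section \<open>Components\<close>

text \<open>
  A component is kept as a graph, i.e. together with its locations: a trivial strongly connected
  component may have no transitions, and narrowing changes the transitions of a component but not
  its locations.
\<close>

type_synonym ('l, 'v) component = "('l, ('l, 'v) transition) pre_digraph"

definition cfg :: "'l set \<Rightarrow> ('l, 'v) program \<Rightarrow> ('l, ('l, 'v) transition) pre_digraph" where
  "cfg \<L> P = \<lparr>verts = \<L>, arcs = P, tail = src, head = tgt\<rparr>"

definition is_component :: "'l set \<Rightarrow> ('l, 'v) program \<Rightarrow> ('l, 'v) component \<Rightarrow> bool" where
  "is_component \<L> P C \<longleftrightarrow> C \<in> pre_digraph.sccs (cfg \<L> P)"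

definition component :: "'l set \<Rightarrow> ('l, 'v) program \<Rightarrow> 'l \<Rightarrow> ('l, 'v) component" where
  "component \<L> P l = induce_subgraph (cfg \<L> P) (pre_digraph.scc_of (cfg \<L> P) l)"

definition entries :: "('l, 'v) component \<Rightarrow> ('l, 'v) program \<Rightarrow> ('l, 'v) transition set" where
  "entries C P = {t \<in> P. t \<notin> arcs C \<and> tgt t \<in> verts C}"

definition exit_transition :: "('l, 'v) component \<Rightarrow> ('l, 'v) transition \<Rightarrow> bool" where
  "exit_transition C t \<longleftrightarrow> t \<notin> arcs C \<and> src t \<in> verts C"


section \<open>Conditional safety by Max-SMT\<close>

text \<open>An assignment gives the coefficients \<open>(i\<^bsub>l,j\<^esub>, (i\<^bsub>l,j,v\<^esub>)\<^sub>v)\<close> of the templates.\<close>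

type_synonym ('l, 'v) assignment = "'l \<Rightarrow> nat \<Rightarrow> real \<times> ('v \<Rightarrow> real)"

definition template_conjunct :: "('l, 'v) assignment \<Rightarrow> 'l \<Rightarrow> nat \<Rightarrow> 'v linineq" where
  "template_conjunct \<sigma> l j = Le (fst (\<sigma> l j)) (snd (\<sigma> l j))"

definition template :: "nat \<Rightarrow> ('l, 'v) assignment \<Rightarrow> 'l \<Rightarrow> 'v conj" where
  "template k \<sigma> l = map (template_conjunct \<sigma> l) [1..<Suc k]"

text \<open>A constraint on the unknowns is represented by the predicate on assignments it denotes.\<close>

record 'a max_smt =
  hard :: "('a \<Rightarrow> bool) set"
  soft :: "(real \<times> ('a \<Rightarrow> bool)) multiset"

definition consecution ::
    "nat \<Rightarrow> ('l, 'v::finite) transition \<Rightarrow> ('l, 'v) assignment \<Rightarrow> bool" where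
  "consecution k t \<sigma> \<longleftrightarrow>
     entails_conj (map unprimed (template k \<sigma> (src t)) @ guard t) (map primed (template k \<sigma> (tgt t)))"

definition safety ::
    "nat \<Rightarrow> ('l, 'v::finite) assertion \<Rightarrow> ('l, 'v) assignment \<Rightarrow> bool" where
  "safety k A \<sigma> \<longleftrightarrow> (case A of (t, \<phi>) \<Rightarrow>
     entails_clause (map unprimed (template k \<sigma> (src t)) @ guard t) (map primed \<phi>))"

definition initiation ::
    "('l, 'v::finite) transition \<Rightarrow> nat \<Rightarrow> ('l, 'v) assignment \<Rightarrow> bool" where
  "initiation t j \<sigma> \<longleftrightarrow> entails_conj (guard t) [primed (template_conjunct \<sigma> (tgt t) j)]"

definition cond_safe_problem ::
    "(('l, 'v::finite) transition \<Rightarrow> nat \<Rightarrow> real) \<Rightarrow> nat \<Rightarrow> ('l, 'v) component \<Rightarrow>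
     ('l, 'v) transition set \<Rightarrow> ('l, 'v) assertion \<Rightarrow> ('l, 'v) assignment max_smt" where
  "cond_safe_problem w k C E A =
     \<lparr>hard = insert (safety k A) (consecution k ` arcs C),
      soft = image_mset (\<lambda>(t, j). (w t j, initiation t j)) (mset_set (E \<times> {1..k}))\<rparr>"

text \<open>
  A solver relates a problem to the answers it may give on it. \<open>None\<close> means that no assignment
  was found; neither completeness nor optimality for the soft constraints is required.
\<close>

type_synonym 'a solver = "'a max_smt \<Rightarrow> 'a option \<Rightarrow> bool"

definition sound_solver :: "'a solver \<Rightarrow> bool" where
  "sound_solver solver \<longleftrightarrow> (\<forall>M \<sigma>. solver M (Some \<sigma>) \<longrightarrow> (\<forall>h\<in>hard M. h \<sigma>))"

text \<open>
  The result maps locations to conjunctions. It is only meaningful, and only used, on the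
  locations of the component.
\<close>

inductive cond_safe ::
    "('l, 'v::finite) assignment solver \<Rightarrow> (('l, 'v) transition \<Rightarrow> nat \<Rightarrow> real) \<Rightarrow> nat \<Rightarrow>
     ('l, 'v) component \<Rightarrow> ('l, 'v) transition set \<Rightarrow> ('l, 'v) assertion \<Rightarrow>
     ('l \<Rightarrow> 'v conj) option \<Rightarrow> bool"
  for solver w max_conjuncts C E A where
  found: "k \<in> {1..max_conjuncts} \<Longrightarrow>
    (\<And>i. i \<in> {1..<k} \<Longrightarrow> solver (cond_safe_problem w i C E A) None) \<Longrightarrow>
    solver (cond_safe_problem w k C E A) (Some \<sigma>) \<Longrightarrow>
    cond_safe solver w max_conjuncts C E A (Some (template k \<sigma>))"
| not_found: "(\<And>k. k \<in> {1..max_conjuncts} \<Longrightarrow> solver (cond_safe_problem w k C E A) None) \<Longrightarrow>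
    cond_safe solver w max_conjuncts C E A None"


section \<open>The safety checking procedure\<close>

datatype result = Safe | Maybe

text \<open>
  Narrowing, with one transition per disjunct of the negated conjunctions. An entry transition
  none of whose results is \<open>Maybe\<close> is conjoined with the negation of the empty conjunction and
  hence disappears.
\<close>

definition narrow_entries ::
    "('l \<Rightarrow> 'v conj) \<Rightarrow> (('l, 'v) transition \<Rightarrow> 'v linineq \<Rightarrow> result) \<Rightarrow>
     ('l, 'v) transition set \<Rightarrow> ('l, 'v) transition set" where
  "narrow_entries Q res E =
     {(src t, guard t @ [neg (primed L)], tgt t) | t L.
        t \<in> E \<and> L \<in> set (Q (tgt t)) \<and> res t L = Maybe}"

definition narrow_component ::
    "('l \<Rightarrow> 'v conj) \<Rightarrow> ('l, 'v) component \<Rightarrow> ('l, 'v) component" where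
  "narrow_component Q C = C\<lparr>arcs :=
     {(src t, guard t @ [neg (primed L'), neg (unprimed L)], tgt t) | t L' L.
        t \<in> arcs C \<and> L' \<in> set (Q (tgt t)) \<and> L \<in> set (Q (src t))}\<rparr>"

text \<open>
  \<open>check_safe \<L> l0 P solver w max_conjuncts C E A r\<close>: some run of the procedure on \<open>C\<close>, \<open>E\<close> and
  \<open>A\<close> terminates with result \<open>r\<close>. It is a relation because the solver may be nondeterministic and
  the procedure need not terminate (narrowing may go on forever).
\<close>

inductive check_safe ::
    "'l set \<Rightarrow> 'l \<Rightarrow> ('l, 'v::finite) program \<Rightarrow> ('l, 'v) assignment solver \<Rightarrow>
     (('l, 'v) transition \<Rightarrow> nat \<Rightarrow> real) \<Rightarrow> nat \<Rightarrow> ('l, 'v) component \<Rightarrow>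
     ('l, 'v) transition set \<Rightarrow> ('l, 'v) assertion \<Rightarrow> result \<Rightarrow> bool"
  for \<L> l0 P solver w max_conjuncts where
  trivially_safe: "entails_clause (guard t) (map primed \<phi>) \<Longrightarrow>
    check_safe \<L> l0 P solver w max_conjuncts C E (t, \<phi>) Safe"
| at_start: "\<not> entails_clause (guard t) (map primed \<phi>) \<Longrightarrow> src t = l0 \<Longrightarrow>
    check_safe \<L> l0 P solver w max_conjuncts C E (t, \<phi>) Maybe"
| no_invariant: "\<not> entails_clause (guard t) (map primed \<phi>) \<Longrightarrow> src t \<noteq> l0 \<Longrightarrow>
    cond_safe solver w max_conjuncts C E (t, \<phi>) None \<Longrightarrow>
    check_safe \<L> l0 P solver w max_conjuncts C E (t, \<phi>) Maybe"
| all_safe: "\<not> entails_clause (guard t) (map primed \<phi>) \<Longrightarrow> src t \<noteq> l0 \<Longrightarrow>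
    cond_safe solver w max_conjuncts C E (t, \<phi>) (Some Q) \<Longrightarrow>
    (\<And>e L. e \<in> E \<Longrightarrow> L \<in> set (Q (tgt e)) \<Longrightarrow>
       check_safe \<L> l0 P solver w max_conjuncts (component \<L> P (src e))
         (entries (component \<L> P (src e)) P) (e, [L]) (res e L)) \<Longrightarrow>
    (\<forall>e\<in>E. \<forall>L\<in>set (Q (tgt e)). res e L = Safe) \<Longrightarrow>
    check_safe \<L> l0 P solver w max_conjuncts C E (t, \<phi>) Safe"
| narrow: "\<not> entails_clause (guard t) (map primed \<phi>) \<Longrightarrow> src t \<noteq> l0 \<Longrightarrow>
    cond_safe solver w max_conjuncts C E (t, \<phi>) (Some Q) \<Longrightarrow>
    (\<And>e L. e \<in> E \<Longrightarrow> L \<in> set (Q (tgt e)) \<Longrightarrow>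
       check_safe \<L> l0 P solver w max_conjuncts (component \<L> P (src e))
         (entries (component \<L> P (src e)) P) (e, [L]) (res e L)) \<Longrightarrow>
    \<not> (\<forall>e\<in>E. \<forall>L\<in>set (Q (tgt e)). res e L = Safe) \<Longrightarrow>
    check_safe \<L> l0 P solver w max_conjuncts (narrow_component Q C) (narrow_entries Q res E)
      (t, \<phi>) r \<Longrightarrow>
    check_safe \<L> l0 P solver w max_conjuncts C E (t, \<phi>) r"

end

(* Every evaluation that reaches a component avoiding the start location splits into a reachable
   state, an entry step and steps within the component. Along the last part the conditional
   invariant, once it holds, holds until the exit. So if it fails at the exit, it fails at all
   states after the entry; then all these steps are steps of the narrowed component, and the entry
   violates a conjunct of the invariant whose check returned Maybe, so it is a narrowed entry. *)

theory Submission
  imports Defs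
begin

section \<open>Satisfaction of formulas and of steps\<close>

lemma sat_conj_Cons: "sat_conj \<nu> (L # F) \<longleftrightarrow> sat \<nu> L \<and> sat_conj \<nu> F"
  by (simp add: sat_conj_def)

lemma sat_conj_append: "sat_conj \<nu> (F @ G) \<longleftrightarrow> sat_conj \<nu> F \<and> sat_conj \<nu> G"
  by (auto simp: sat_conj_def)

lemma sat_conj_unprimed: "sat_conj (case_sum u u') (map unprimed F) \<longleftrightarrow> sat_conj u F"
  by (simp add: sat_conj_def sat_unprimed)

lemma sat_conj_primed: "sat_conj (case_sum u u') (map primed F) \<longleftrightarrow> sat_conj u' F"
  by (simp add: sat_conj_def sat_primed)

lemma sat_clause_primed: "sat_clause (case_sum u u') (map primed \<phi>) \<longleftrightarrow> sat_clause u' \<phi>"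
  by (simp add: sat_clause_def sat_primed)

lemma step_iff:
  "step t s s' \<longleftrightarrow>
     fst s = src t \<and> fst s' = tgt t \<and> sat_conj (case_sum (snd s) (snd s')) (guard t)"
  by (cases s; cases s') simp

lemma step_entails_clause:
  assumes "entails_clause (guard t) (map primed \<phi>)" "step t s s'"
  shows "sat_clause (snd s') \<phi>"
  using assms by (auto simp: entails_clause_def step_iff sat_clause_primed)

section \<open>Evaluations that enter a component\<close>

lemma wf_digraph_cfg: "is_program \<L> l0 P \<Longrightarrow> wf_digraph (cfg \<L> P)"
  by unfold_locales (auto simp: is_program_def cfg_def transition_on_def)

lemma reachable_location:
  assumes "is_program \<L> l0 P" "(program_step P)\<^sup>*\<^sup>* (l0, u0) s"
  shows "fst s \<in> \<L>"
  using assms(2,1)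
  by (induction rule: rtranclp_induct)
     (auto simp: is_program_def program_step_def step_iff transition_on_def)

text \<open>Induction on the evaluation. A last step with a transition in \<open>arcs C\<close>
  starts inside \<open>C\<close>, so it extends the decomposition of the shorter evaluation; any
  other last step into \<open>C\<close> is itself the entry. The empty evaluation ends at
  \<open>l0\<close>, outside \<open>C\<close>.\<close>

lemma reachable_through_entry:
  assumes "(program_step P)\<^sup>*\<^sup>* (l0, u0) s" "fst s \<in> verts C" "l0 \<notin> verts C"
    and "\<forall>t\<in>arcs C. src t \<in> verts C"
  obtains s0 e s1 where "(program_step P)\<^sup>*\<^sup>* (l0, u0) s0" "e \<in> entries C P" "step e s0 s1"
    "(program_step (arcs C))\<^sup>*\<^sup>* s1 s"
proof -
  have "\<exists>s0 e s1. (program_step P)\<^sup>*\<^sup>* (l0, u0) s0 \<and> e \<in> entries C P \<and> step e s0 s1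
    \<and> (program_step (arcs C))\<^sup>*\<^sup>* s1 s"
    using assms(1,2)
  proof (induction rule: rtranclp_induct)
    case base
    then show ?case using assms(3) by simp
  next
    case (step y z)
    from \<open>program_step P y z\<close> obtain t where t: "t \<in> P" "Defs.step t y z"
      by (auto simp: program_step_def)
    show ?case
    proof (cases "t \<in> arcs C")
      case True
      with t assms(4) have "fst y \<in> verts C" by (auto simp: step_iff)
      with step.IH True t(2) show ?thesis
        by (metis program_step_def rtranclp.rtrancl_into_rtrancl)
    next
      case False
      with t step.prems have "t \<in> entries C P" by (auto simp: entries_def step_iff)
      with t(2) step.hyps(1) show ?thesis by blast
    qed
  qed
  with that show thesis by blast
qed

text \<open>Safety with \<open>T\<close> and \<open>E\<close> kept as parameters, so that narrowed
  transitions, which may lie outside \<open>P\<close>, are covered as well. Only the part before the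
  entry has to be an evaluation of \<open>P\<close>.\<close>

definition safe_via ::
    "'l \<Rightarrow> ('l, 'v::finite) program \<Rightarrow> ('l, 'v) transition set \<Rightarrow> ('l, 'v) transition set \<Rightarrow>
     ('l, 'v) assertion \<Rightarrow> bool" where
  "safe_via l0 P T E A \<longleftrightarrow> (\<forall>u0 s0 e s1 s2 s3. (program_step P)\<^sup>*\<^sup>* (l0, u0) s0 \<longrightarrow>
     e \<in> E \<longrightarrow> step e s0 s1 \<longrightarrow> (program_step T)\<^sup>*\<^sup>* s1 s2 \<longrightarrow> step (fst A) s2 s3 \<longrightarrow>
     sat_clause (snd s3) (snd A))"

text \<open>At \<open>l0\<close> the evaluation before \<open>t\<close> may be empty and have no
  entry step, hence the separate condition \<open>start\<close>. The condition \<open>inside\<close>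
  is asked only when \<open>src t\<close> is reached, since the sources of narrowed entries are not
  otherwise known to be locations.\<close>

lemma safe_via_imp_safe_for:
  assumes via: "safe_via l0 P (arcs C) (entries C P) (t, \<phi>)"
    and start: "src t = l0 \<Longrightarrow> entails_clause (guard t) (map primed \<phi>)"
    and inside: "\<And>u0 s. (program_step P)\<^sup>*\<^sup>* (l0, u0) s \<Longrightarrow> fst s = src t \<Longrightarrow> src t \<noteq> l0 \<Longrightarrow>
      src t \<in> verts C \<and> l0 \<notin> verts C"
    and C: "\<forall>t\<in>arcs C. src t \<in> verts C"
  shows "safe_for l0 P (t, \<phi>)"
  unfolding safe_for_def prod.case
proof (intro allI impI)
  fix u0 s l u assume s: "(program_step P)\<^sup>*\<^sup>* (l0, u0) s" "step t s (l, u)"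
  show "sat_clause u \<phi>"
  proof (cases "src t = l0")
    case True
    with start s(2) show ?thesis using step_entails_clause by fastforce
  next
    case False
    from s(2) have "fst s = src t" by (simp add: step_iff)
    with inside[OF s(1)] False have "fst s \<in> verts C" "l0 \<notin> verts C" by auto
    from reachable_through_entry[OF s(1) this C] obtain s0 e s1 where
      "(program_step P)\<^sup>*\<^sup>* (l0, u0) s0" "e \<in> entries C P" "step e s0 s1"
      "(program_step (arcs C))\<^sup>*\<^sup>* s1 s" .
    with via s(2) show ?thesis unfolding safe_via_def by (metis fst_conv snd_conv)
  qed
qed

lemma safe_via_component_imp_safe_for:
  assumes "is_program \<L> l0 P" "pre_digraph.scc_of (cfg \<L> P) l0 = {l0}"
    and via: "safe_via l0 P (arcs (component \<L> P (src t))) (entries (component \<L> P (src t)) P) (t, \<phi>)"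
    and start: "src t = l0 \<Longrightarrow> entails_clause (guard t) (map primed \<phi>)"
  shows "safe_for l0 P (t, \<phi>)"
proof (rule safe_via_imp_safe_for[OF via start])
  fix u0 s assume "(program_step P)\<^sup>*\<^sup>* (l0, u0) s" "fst s = src t" and ne: "src t \<noteq> l0"
  with reachable_location[OF assms(1), of u0 s] have "src t \<in> verts (cfg \<L> P)"
    by (simp add: cfg_def)
  then have "src t \<in> verts (component \<L> P (src t))"
    using wf_digraph.reachable_refl[OF wf_digraph_cfg[OF assms(1)]]
    by (simp add: component_def pre_digraph.scc_of_def)
  \<comment> \<open>Mutual reachability is symmetric, so \<open>l0\<close> in the component of
    \<open>src t\<close> would put \<open>src t\<close> into that of \<open>l0\<close>.\<close>
  moreover have "l0 \<notin> verts (component \<L> P (src t))"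
  proof
    assume "l0 \<in> verts (component \<L> P (src t))"
    then have "src t \<in> pre_digraph.scc_of (cfg \<L> P) l0"
      by (simp add: component_def pre_digraph.scc_of_def)
    with assms(2) ne show False by simp
  qed
  ultimately show "src t \<in> verts (component \<L> P (src t)) \<and> l0 \<notin> verts (component \<L> P (src t))"
    by simp
qed (auto simp: component_def cfg_def)

section \<open>Conditional invariants and narrowing\<close>

text \<open>Both claims are hard constraints, consecution and safety, evaluated at the joint
  valuation of the two states. Initiation is soft, so nothing is claimed about entries.\<close>

lemma cond_safe_sound:
  assumes "sound_solver solver" "cond_safe solver w max_conjuncts C E (t, \<phi>) (Some Q)"
  shows "\<And>t' s s'. t' \<in> arcs C \<Longrightarrow> step t' s s' \<Longrightarrow> sat_conj (snd s) (Q (fst s)) \<Longrightarrow>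
      sat_conj (snd s') (Q (fst s'))"
    and "\<And>s s'. step t s s' \<Longrightarrow> sat_conj (snd s) (Q (fst s)) \<Longrightarrow> sat_clause (snd s') \<phi>"
proof -
  from assms(2) obtain k \<sigma> where Q: "Q = template k \<sigma>"
    and \<sigma>: "solver (cond_safe_problem w k C E (t, \<phi>)) (Some \<sigma>)"
    by (cases rule: cond_safe.cases) auto
  from assms(1) \<sigma> have hard: "\<forall>h\<in>hard (cond_safe_problem w k C E (t, \<phi>)). h \<sigma>"
    by (auto simp: sound_solver_def)
  show "sat_conj (snd s') (Q (fst s'))"
    if "t' \<in> arcs C" "step t' s s'" "sat_conj (snd s) (Q (fst s))" for t' s s'
  proof -
    from hard that(1) have "consecution k t' \<sigma>" by (simp add: cond_safe_problem_def)
    with that(2,3) show ?thesis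
      by (auto simp: consecution_def entails_conj_def step_iff Q sat_conj_append
          sat_conj_unprimed sat_conj_primed dest: spec[of _ "case_sum (snd s) (snd s')"])
  qed
  show "sat_clause (snd s') \<phi>" if "step t s s'" "sat_conj (snd s) (Q (fst s))" for s s'
  proof -
    from hard have "safety k (t, \<phi>) \<sigma>" by (simp add: cond_safe_problem_def)
    with that show ?thesis
      by (auto simp: safety_def entails_clause_def step_iff Q sat_conj_append
          sat_conj_unprimed sat_clause_primed dest: spec[of _ "case_sum (snd s) (snd s')"])
  qed
qed

text \<open>A conjunct violated before the step and one violated after it select the disjuncts of
  the two negations, and thereby the narrowed transition to use.\<close>

lemma narrow_component_step:
  assumes "t \<in> arcs C" "step t s s'"
    and "\<not> sat_conj (snd s) (Q (fst s))" "\<not> sat_conj (snd s') (Q (fst s'))"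
  shows "program_step (arcs (narrow_component Q C)) s s'"
proof -
  from assms obtain L L' where L: "L \<in> set (Q (src t))" "\<not> sat (snd s) L"
    "L' \<in> set (Q (tgt t))" "\<not> sat (snd s') L'"
    by (auto simp: sat_conj_def step_iff)
  let ?t = "(src t, guard t @ [neg (primed L'), neg (unprimed L)], tgt t)"
  have "?t \<in> arcs (narrow_component Q C)"
    using assms(1) L unfolding narrow_component_def by (simp del: split_paired_Ex) blast
  moreover have "step ?t s s'"
    using assms(2) L
    by (simp add: step_iff src_def tgt_def guard_def sat_conj_append sat_conj_Cons sat_neg
        sat_primed sat_unprimed) (simp add: sat_conj_def)
  ultimately show ?thesis by (auto simp: program_step_def)
qed

text \<open>Invariance is used contrapositively: failure of \<open>Q\<close> after a step gives
  failure before it, which is what the induction hypothesis for the shorter path requires.\<close>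

lemma narrow_component_path:
  assumes "(program_step (arcs C))\<^sup>*\<^sup>* s s'" "\<not> sat_conj (snd s') (Q (fst s'))"
    and "\<And>t s s'. t \<in> arcs C \<Longrightarrow> step t s s' \<Longrightarrow> sat_conj (snd s) (Q (fst s)) \<Longrightarrow>
      sat_conj (snd s') (Q (fst s'))"
  shows "\<not> sat_conj (snd s) (Q (fst s)) \<and> (program_step (arcs (narrow_component Q C)))\<^sup>*\<^sup>* s s'"
  using assms(1,2)
proof (induction rule: rtranclp_induct)
  case (step y z)
  from step.hyps(2) obtain t where t: "t \<in> arcs C" "Defs.step t y z"
    by (auto simp: program_step_def)
  from assms(3)[OF t] step.prems have y: "\<not> sat_conj (snd y) (Q (fst y))" by blast
  from step.IH[OF y] narrow_component_step[OF t y step.prems] show ?case by auto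
qed simp

lemma narrow_entries_step:
  assumes "e \<in> E" "step e s s'" "L \<in> set (Q (tgt e))" "\<not> sat (snd s') L" "res e L = Maybe"
  obtains e' where "e' \<in> narrow_entries Q res E" "step e' s s'"
proof
  let ?e = "(src e, guard e @ [neg (primed L)], tgt e)"
  show "?e \<in> narrow_entries Q res E"
    using assms(1,3,5) unfolding narrow_entries_def by blast
  show "step ?e s s'"
    using assms(2,4)
    by (simp add: step_iff src_def tgt_def guard_def sat_conj_append sat_conj_Cons sat_neg
        sat_primed) (simp add: sat_conj_def)
qed

lemma safe_via_narrow:
  assumes "sound_solver solver" "cond_safe solver w max_conjuncts C E (t, \<phi>) (Some Q)"
    and res: "\<And>e L. e \<in> E \<Longrightarrow> L \<in> set (Q (tgt e)) \<Longrightarrow> res e L = Safe \<Longrightarrow>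
      safe_for l0 P (e, [L])"
    and narrowed: "safe_via l0 P (arcs (narrow_component Q C)) (narrow_entries Q res E) (t, \<phi>)"
  shows "safe_via l0 P (arcs C) E (t, \<phi>)"
  unfolding safe_via_def fst_conv snd_conv
proof (intro allI impI)
  fix u0 s0 e s1 s2 s3
  assume s0: "(program_step P)\<^sup>*\<^sup>* (l0, u0) s0" and e: "e \<in> E" "step e s0 s1"
    and path: "(program_step (arcs C))\<^sup>*\<^sup>* s1 s2" and exit: "step t s2 s3"
  note sound = cond_safe_sound[OF assms(1,2)]
  show "sat_clause (snd s3) \<phi>"
  proof (cases "sat_conj (snd s2) (Q (fst s2))")
    case True
    with sound(2)[OF exit] show ?thesis by blast
  next
    case False
    have "\<not> sat_conj (snd s1) (Q (fst s1)) \<and>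
      (program_step (arcs (narrow_component Q C)))\<^sup>*\<^sup>* s1 s2"
      using path False by (rule narrow_component_path) (rule sound(1))
    then have s1: "\<not> sat_conj (snd s1) (Q (fst s1))"
      and path': "(program_step (arcs (narrow_component Q C)))\<^sup>*\<^sup>* s1 s2" by blast+
    from s1 e(2) obtain L where L: "L \<in> set (Q (tgt e))" "\<not> sat (snd s1) L"
      by (auto simp: sat_conj_def step_iff)
    \<comment> \<open>With result \<open>Safe\<close>, \<open>L\<close> would hold after every step
      by \<open>e\<close> from a state reachable in \<open>P\<close>, in particular at
      \<open>s1\<close>.\<close>
    have "res e L = Maybe"
    proof (rule ccontr)
      assume "res e L \<noteq> Maybe"
      then have "res e L = Safe" by (cases "res e L") auto
      from res[OF e(1) L(1) this] s0 e(2) have "sat_clause (snd s1) [L]"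
        unfolding safe_for_def prod.case by (metis prod.collapse)
      with L(2) show False by (simp add: sat_clause_def)
    qed
    with e L obtain e' where "e' \<in> narrow_entries Q res E" "step e' s0 s1"
      by (rule narrow_entries_step)
    with narrowed s0 path' exit show ?thesis
      unfolding safe_via_def fst_conv snd_conv by blast
  qed
qed

section \<open>Soundness of the procedure\<close>

text \<open>Induction on the run. The second conjunct serves the recursive calls on entries that
  leave \<open>l0\<close>: there only the trivial check can answer \<open>Safe\<close>. With
  \<open>r = Safe\<close> as a separate premise, the rules yielding \<open>Maybe\<close> hold
  vacuously.\<close>

lemma check_safe_sound:
  assumes "check_safe \<L> l0 P solver w max_conjuncts C E A r"
    and "is_program \<L> l0 P" "pre_digraph.scc_of (cfg \<L> P) l0 = {l0}" "sound_solver solver"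
    and "r = Safe"
  shows "safe_via l0 P (arcs C) E A \<and>
    (src (fst A) = l0 \<longrightarrow> entails_clause (guard (fst A)) (map primed (snd A)))"
  using assms(1,5)
proof (induction rule: check_safe.induct)
  case (trivially_safe t \<phi> C E)
  then show ?case using step_entails_clause unfolding safe_via_def fst_conv snd_conv by blast
next
  case (all_safe t \<phi> C E Q res)
  \<comment> \<open>Without a result \<open>Maybe\<close> no narrowed entry remains, so this case is
    narrowing with a vacuous recursive claim.\<close>
  have "narrow_entries Q res E = {}"
    using all_safe.hyps(5) by (auto simp: narrow_entries_def)
  then have "safe_via l0 P (arcs (narrow_component Q C)) (narrow_entries Q res E) (t, \<phi>)"
    by (simp add: safe_via_def)
  then have "safe_via l0 P (arcs C) E (t, \<phi>)"
    using all_safe.IH safe_via_component_imp_safe_for[OF assms(2,3)]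
    by (intro safe_via_narrow[OF assms(4) all_safe.hyps(3)]) auto
  with all_safe.hyps(2) show ?case by simp
next
  case (narrow t \<phi> C E Q res r)
  then have "safe_via l0 P (arcs C) E (t, \<phi>)"
    using safe_via_component_imp_safe_for[OF assms(2,3)]
    by (intro safe_via_narrow[OF assms(4) narrow.hyps(3)]) auto
  with narrow.hyps(2) show ?case by simp
qed auto

text \<open>Strong connectedness of \<open>C\<close> carries over to the whole control-flow graph,
  so \<open>l\<close> lies in the component of \<open>l0\<close>.\<close>

lemma is_component_start:
  assumes "is_program \<L> l0 P" "pre_digraph.scc_of (cfg \<L> P) l0 = {l0}"
    and "is_component \<L> P C" "l0 \<in> verts C" "l \<in> verts C"
  shows "l = l0"
proof -
  interpret G: wf_digraph "cfg \<L> P" using assms(1) by (rule wf_digraph_cfg)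
  from assms(3) have "subgraph C (cfg \<L> P)" "strongly_connected C"
    by (auto simp: is_component_def G.sccs_def induced_subgraph_def)
  with assms(4,5) have "l \<in> G.scc_of l0"
    by (auto simp: strongly_connected_def G.scc_of_def intro: G.reachable_mono)
  with assms(2) show ?thesis by simp
qed

lemma is_component_src:
  assumes "is_component \<L> P C" "t \<in> arcs C"
  shows "src t \<in> verts C"
  using assms
  by (auto simp: is_component_def pre_digraph.sccs_def induced_subgraph_def cfg_def)

theorem theorem2:
  fixes \<L> :: "'l set" and l0 :: 'l and P :: "('l, 'v::finite) program"
    and C :: "('l, 'v) component" and E :: "('l, 'v) transition set"
    and t_exit :: "('l, 'v) transition" and \<phi> :: "'v clause"
    and solver :: "('l, 'v) assignment solver"
    and w :: "('l, 'v) transition \<Rightarrow> nat \<Rightarrow> real" and max_conjuncts :: nat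
  assumes "is_program \<L> l0 P"
    and start_alone: "pre_digraph.scc_of (cfg \<L> P) l0 = {l0}"
    and "sound_solver solver"
    and "is_component \<L> P C"
    and "E = entries C P"
    and "transition_on \<L> t_exit"
    and "exit_transition C t_exit"
    and "check_safe \<L> l0 P solver w max_conjuncts C E (t_exit, \<phi>) Safe"
  shows "safe_for l0 P (t_exit, \<phi>)"
proof -
  from check_safe_sound[OF assms(8,1,2,3)] assms(5)
  have via: "safe_via l0 P (arcs C) (entries C P) (t_exit, \<phi>)"
    and start: "src t_exit = l0 \<Longrightarrow> entails_clause (guard t_exit) (map primed \<phi>)"
    by auto
  show ?thesis
  proof (rule safe_via_imp_safe_for[OF via start])
    \<comment> \<open>The exit leaves from a location of \<open>C\<close>; if \<open>l0\<close> were
      in \<open>C\<close> too, that location would be \<open>l0\<close>.\<close>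
    assume "src t_exit \<noteq> l0"
    with assms(7) is_component_start[OF assms(1,2,4)]
    show "src t_exit \<in> verts C \<and> l0 \<notin> verts C"
      by (auto simp: exit_transition_def)
  qed (use is_component_src[OF assms(4)] in auto)
qed

end
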